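(* Let $R>0$ be a tuning parameter and consider the regression model $y=f_0+\xi$ with $\xi\sim\mathcal{N}(0,\sigma^2I_{n\times n})$, where $f_0\in\mathbb{R}^n$ is an unknown mean. Let $x_1,\dots,x_M\in\mathbb{R}^n$ with $\frac1n|x_j|_2^2\le 1$ for all $j=1,\dots,M$, and let $\mathbf{X}$ be the $n\times M$ matrix with columns $x_1,\dots,x_M$. Define the constrained Lasso estimator by $$\hat\beta\in\operatorname*{argmin}_{\beta\in\mathbb{R}^M:\ |\beta|_1\le R}|y-\mathbf{X}\beta|_2^2 .$$ Then for all $x>0$, with probability greater than $1-\exp(-x)$, $$\frac1n|\mathbf{X}\hat\beta-f_0|_2^2\;\le\;\min_{\beta\in\mathbb{R}^M:\ |\beta|_1\le R}\frac1n|\mathbf{X}\beta-f_0|_2^2+2t_*^2+\frac{4\sigma^2x}{n},$$ where $$t_*^2=\min\left(\frac{4\sigma^2\operatorname{rank}(\mathbf{X})}{n},\;\frac{62\,\sigma R\sqrt{\log\left(2eM\sigma/(R\sqrt n)\right)}}{\sqrt n}\right).$$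
   Context: Here $n,M\ge1$ are integers, $\sigma>0$, and $f_0,x_1,\dots,x_M$ are deterministic. $|\cdot|_2$ is the Euclidean norm on $\mathbb{R}^n$ and $|\beta|_1=\sum_{j=1}^M|\beta_j|$ for $\beta=(\beta_1,\dots,\beta_M)^T\in\mathbb{R}^M$.
   Formalization: In t_*^2 the logarithm is replaced by max(1, log(2eMσ/(R√n))), since the literal formula is undefined for R√n > 2eMσ and the bound can fail at R√n = 2eMσ; t_*^2 is unchanged whenever the literal logarithm is at least 1/900. *)

theory Defs
  imports "HOL-Analysis.Analysis" "HOL-Probability.Probability"
begin

definition l1_norm :: "real^'m \<Rightarrow> real" where
  "l1_norm b = (\<Sum>j\<in>UNIV. \<bar>b $ j\<bar>)"

text \<open>Lebesgue density of the multivariate normal law with mean \<open>\<mu>\<close> and covariance \<open>\<sigma>\<^sup>2 I\<close>;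
  meant for \<open>\<sigma> > 0\<close>.\<close>

definition iso_normal_density :: "real^'n \<Rightarrow> real \<Rightarrow> real^'n \<Rightarrow> real" where
  "iso_normal_density \<mu> \<sigma> z =
     1 / sqrt (2 * pi * \<sigma>\<^sup>2) ^ CARD('n) * exp (- (norm (z - \<mu>))\<^sup>2 / (2 * \<sigma>\<^sup>2))"

lemma iso_normal_density_eq_prod:
  "iso_normal_density \<mu> \<sigma> z = (\<Prod>i\<in>UNIV. normal_density (\<mu> $ i) \<sigma> (z $ i))"
proof -
  have "(norm (z - \<mu>))\<^sup>2 = (\<Sum>i\<in>UNIV. (z $ i - \<mu> $ i)\<^sup>2)"
    by (simp add: norm_vec_def L2_set_def sum_nonneg)
  then have "exp (- (norm (z - \<mu>))\<^sup>2 / (2 * \<sigma>\<^sup>2))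
      = (\<Prod>i\<in>UNIV. exp (- (z $ i - \<mu> $ i)\<^sup>2 / (2 * \<sigma>\<^sup>2)))"
    by (simp add: exp_sum [symmetric] sum_negf sum_divide_distrib)
  then show ?thesis
    by (simp add: iso_normal_density_def normal_density_def prod_dividef)
qed

text \<open>The logarithm in the rate is truncated from below at \<open>1\<close>.  With the plain \<open>ln\<close> the square
  root is meaningless when its argument is below \<open>1\<close> (in HOL it would be negative), and for an
  argument equal to \<open>1\<close> the rate would vanish.  The truncation leaves the minimum unchanged as
  soon as the plain logarithm is at least \<open>1/900\<close>: see \<open>lasso_rate_eq_untruncated\<close> below.\<close>

definition log_plus :: "real \<Rightarrow> real" where
  "log_plus a = max 1 (ln a)"

text \<open>The quantity \<open>t\<^sub>*\<^sup>2\<close>; the columns of \<open>X\<close> are the \<open>M = CARD('m)\<close> regressors in dimension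
  \<open>n = CARD('n)\<close>.\<close>

definition lasso_rate :: "real \<Rightarrow> real \<Rightarrow> real^'m^'n \<Rightarrow> real" where
  "lasso_rate \<sigma> R X =
     (let n = real CARD('n); M = real CARD('m) in
      min (4 * \<sigma>\<^sup>2 * real (rank X) / n)
          (62 * \<sigma> * R * sqrt (log_plus (2 * exp 1 * M * \<sigma> / (R * sqrt n))) / sqrt n))"

lemma lasso_rate_eq_untruncated:
  fixes X :: "real^'m^'n"
  defines "n \<equiv> real CARD('n)" and "M \<equiv> real CARD('m)"
  assumes "0 < \<sigma>" "0 < R" and L: "1 / 900 \<le> ln (2 * exp 1 * M * \<sigma> / (R * sqrt n))"
  shows "lasso_rate \<sigma> R X =
      min (4 * \<sigma>\<^sup>2 * real (rank X) / n)
          (62 * \<sigma> * R * sqrt (ln (2 * exp 1 * M * \<sigma> / (R * sqrt n))) / sqrt n)"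
proof -
  define a where "a = 2 * exp 1 * M * \<sigma> / (R * sqrt n)"
  have n: "0 < n" and M: "0 < M" by (simp_all add: n_def M_def)
  have a: "0 < a" using assms n M by (simp add: a_def)
  have rank: "real (rank X) \<le> M"
    using rank_bound[of X] by (simp add: M_def)
  have second: "4 * \<sigma>\<^sup>2 * real (rank X) / n \<le> 62 * \<sigma> * R * sqrt l / sqrt n"
    if "ln a < 1" "1 / 900 \<le> l" for l
  proof -
    have "a \<le> exp 1" using that a by (metis exp_le_cancel_iff exp_ln less_imp_le)
    then have "2 * exp 1 * M * \<sigma> \<le> exp 1 * (R * sqrt n)"
      using assms n by (simp add: a_def divide_le_eq)
    then have "exp 1 * (2 * M * \<sigma>) \<le> exp 1 * (R * sqrt n)"
      by (simp only: mult_ac)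
    then have R: "2 * M * \<sigma> \<le> R * sqrt n"
      by (rule mult_left_le_imp_le) simp
    have "sqrt (1 / 900) \<le> sqrt l" using that by simp
    moreover have "sqrt (1 / 900 :: real) = 1 / 30"
      by (rule real_sqrt_unique) (simp_all add: power2_eq_square)
    ultimately have l: "1 / 30 \<le> sqrt l" by simp
    have "4 * \<sigma>\<^sup>2 * real (rank X) \<le> 4 * \<sigma>\<^sup>2 * M"
      using rank by (simp add: mult_left_mono)
    also have "\<dots> \<le> 62 * \<sigma> * (2 * M * \<sigma>) * (1 / 30)"
      using assms M by (simp add: power2_eq_square field_simps)
    also have "\<dots> \<le> 62 * \<sigma> * (R * sqrt n) * sqrt l"
      using assms n M by (intro mult_mono[OF mult_left_mono[OF R] l]) auto
    finally have "4 * \<sigma>\<^sup>2 * real (rank X) / n \<le> 62 * \<sigma> * (R * sqrt n) * sqrt l / n"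
      using n by (simp add: divide_right_mono)
    also have "\<dots> = 62 * \<sigma> * R * sqrt l / sqrt n"
    proof -
      have "62 * \<sigma> * (R * sqrt n) * sqrt l / n = 62 * \<sigma> * R * sqrt l * (sqrt n / n)"
        by simp
      also have "sqrt n / n = 1 / sqrt n"
        using n by (simp add: frac_eq_eq)
      finally show ?thesis by simp
    qed
    finally show ?thesis .
  qed
  show ?thesis
  proof (cases "ln a < 1")
    case True
    then show ?thesis
      using second[of 1] second[of "ln a"] L
      by (simp add: lasso_rate_def Let_def log_plus_def n_def M_def a_def min_absorb1)
  next
    case False
    then show ?thesis
      by (simp add: lasso_rate_def Let_def log_plus_def n_def M_def a_def max_absorb2)
  qed
qed

end

theory Submission
  imports Defs
begin

text \<open>
  Let \<open>C\<close> be the image under \<open>X\<close> of the \<open>\<ell>\<^sub>1\<close>-ball of radius \<open>R\<close>, let \<open>u\<close> be the point of \<open>C\<close>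
  closest to \<open>f0\<close>, and let \<open>v = X *v \<beta>hat\<close>, the point of \<open>C\<close> closest to \<open>y\<close>.  The
  variational inequality for \<open>v\<close> (lemma \<open>projection_basic_inequality\<close>) bounds the excess of
  \<open>\<parallel>v - f0\<parallel>\<^sup>2\<close> over its minimum \<open>\<parallel>u - f0\<parallel>\<^sup>2\<close> on \<open>C\<close> by \<open>2 \<xi> \<bullet> h - \<parallel>h\<parallel>\<^sup>2\<close> with \<open>h = v - u\<close>.
  After division by \<open>\<sigma>\<^sup>2\<close> the noise is a standard Gaussian vector \<open>g\<close>, and it remains to bound
  the upper tail of \<open>Z = sup\<^sub>h (2 g \<bullet> h - \<parallel>h\<parallel>\<^sup>2)\<close>.  The target
  \<open>P (Z > a + 4 x) < exp (- x)\<close> has exactly the form produced by the exponential Markov inequality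
  for \<open>exp (Z / 4)\<close>, and the negative quadratic term in \<open>Z\<close> makes this moment small:
  \<open>exp ((2 g \<bullet> h - \<parallel>h\<parallel>\<^sup>2) / 4)\<close> has expectation \<open>exp (- \<parallel>h\<parallel>\<^sup>2 / 8) \<le> 1\<close> for each fixed \<open>h\<close>.

  The two terms in the rate come from two ways to deal with the supremum.

  For the rank term, \<open>h\<close> ranges over a subspace of dimension \<open>r\<close>.  Then \<open>Z\<close> is at most the squared
  norm of the projection of \<open>g\<close> to that subspace, a chi-square variable, and the moment is
  \<open>2 powr (r / 2)\<close>, which is less than \<open>exp (2 r)\<close> (lemma \<open>gaussian_subspace_tail\<close>).

  For the \<open>\<ell>\<^sub>1\<close> term, \<open>C / \<sigma>\<close> lies in the convex hull of \<open>2 M\<close> vectors of norm at most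
  \<open>S = R sqrt n / \<sigma>\<close>, and Maurey's argument replaces the supremum by a maximum over averages of
  \<open>k\<close> of these vectors.  As the functional is a concave quadratic, the passage to averages costs
  only \<open>S\<^sup>2 / (4 k)\<close>, uniformly in \<open>g\<close> (lemma \<open>maurey_quadratic\<close>), while the number of averages is
  at most \<open>(e (1 + 2 M / k)) ^ k\<close>.  With \<open>L\<close> the truncated logarithm and \<open>k\<close> of order
  \<open>S / sqrt L\<close> both contributions are of order \<open>S sqrt L\<close>.  If \<open>S < sqrt L\<close>, no such \<open>k\<close> exists;
  there the linear functional is bounded by its maximum over the vertices and the exponential
  inequality is used with the larger exponent \<open>sqrt L / S\<close> (lemma \<open>gaussian_hull_tail\<close>).
\<close>

section \<open>Exponential moments of standard Gaussian vectors\<close>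

text \<open>The standard normal law on a Euclidean space, encoded by its moment generating function: this is
  the property that all exponential estimates below start from, and it refers to no basis.\<close>

definition gaussian_mgf :: "'w measure \<Rightarrow> ('w \<Rightarrow> 'a::euclidean_space) \<Rightarrow> bool" where
  "gaussian_mgf P g \<longleftrightarrow> g \<in> borel_measurable P \<and>
     (\<forall>v. (\<integral>\<^sup>+\<omega>. ennreal (exp (g \<omega> \<bullet> v)) \<partial>P) = ennreal (exp ((norm v)\<^sup>2 / 2)))"

lemma gaussian_mgf_affine:
  assumes "gaussian_mgf P g"
  shows "(\<integral>\<^sup>+\<omega>. ennreal (exp (g \<omega> \<bullet> v + c)) \<partial>P) = ennreal (exp ((norm v)\<^sup>2 / 2 + c))"
proof -
  have [measurable]: "g \<in> borel_measurable P" using assms by (simp add: gaussian_mgf_def)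
  have "(\<integral>\<^sup>+\<omega>. ennreal (exp (g \<omega> \<bullet> v + c)) \<partial>P)
      = (\<integral>\<^sup>+\<omega>. ennreal (exp c) * ennreal (exp (g \<omega> \<bullet> v)) \<partial>P)"
    by (simp add: exp_add ennreal_mult' mult.commute)
  also have "\<dots> = ennreal (exp c) * ennreal (exp ((norm v)\<^sup>2 / 2))"
    using assms by (subst nn_integral_cmult) (auto simp: gaussian_mgf_def)
  finally show ?thesis by (simp add: exp_add ennreal_mult' mult.commute)
qed

text \<open>Exponential tilting: multiplying the centred density by \<open>exp (z \<bullet> v / \<sigma>)\<close> gives, up to the
  constant \<open>exp (\<parallel>v\<parallel>\<^sup>2 / 2)\<close>, the density with mean \<open>\<sigma> v\<close>.  Its total mass is \<open>1\<close> by
  translation invariance, because the centred density is the law of \<open>\<xi>\<close>.\<close>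

lemma gaussian_mgf_of_density:
  fixes \<xi> :: "'w \<Rightarrow> real^'n"
  assumes P: "prob_space P" and \<sigma>: "0 < \<sigma>"
    and D: "distributed P lborel \<xi> (\<lambda>z. ennreal (iso_normal_density 0 \<sigma> z))"
  shows "gaussian_mgf P (\<lambda>\<omega>. (1 / \<sigma>) *\<^sub>R \<xi> \<omega>)"
proof -
  interpret prob_space P by fact
  have [measurable]: "\<xi> \<in> borel_measurable P" using D by (simp add: distributed_def)
  have dm [measurable]: "iso_normal_density \<mu> \<sigma> \<in> borel_measurable borel" for \<mu> :: "real^'n"
    unfolding iso_normal_density_def by measurable
  have total: "(\<integral>\<^sup>+z. ennreal (iso_normal_density 0 \<sigma> z) \<partial>(lborel :: (real^'n) measure)) = 1"
    using distributed_nn_integral[OF D, of "\<lambda>_. 1"] by (simp add: emeasure_space_1)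
  have mean: "(\<integral>\<^sup>+z. ennreal (iso_normal_density \<mu> \<sigma> z) \<partial>lborel) = 1" for \<mu> :: "real^'n"
  proof -
    have "(\<integral>\<^sup>+z. ennreal (iso_normal_density \<mu> \<sigma> z) \<partial>lborel)
        = (\<integral>\<^sup>+z. ennreal (iso_normal_density \<mu> \<sigma> z) \<partial>distr lborel borel ((+) \<mu>))"
      by (simp add: lborel_distr_plus)
    also have "\<dots> = (\<integral>\<^sup>+z. ennreal (iso_normal_density \<mu> \<sigma> (\<mu> + z)) \<partial>lborel)"
      by (subst nn_integral_distr) auto
    also have "\<dots> = 1" using total by (simp add: iso_normal_density_def)
    finally show ?thesis .
  qed
  have shift: "iso_normal_density 0 \<sigma> z * exp ((1 / \<sigma>) *\<^sub>R z \<bullet> v)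
      = exp ((norm v)\<^sup>2 / 2) * iso_normal_density (\<sigma> *\<^sub>R v) \<sigma> z" for z v :: "real^'n"
  proof -
    have "(norm (z - \<sigma> *\<^sub>R v))\<^sup>2 = (norm z)\<^sup>2 - 2 * \<sigma> * (z \<bullet> v) + \<sigma>\<^sup>2 * (norm v)\<^sup>2"
      unfolding power2_norm_eq_inner by (simp add: inner_simps algebra_simps inner_commute power2_eq_square)
    then have "- (norm z)\<^sup>2 / (2 * \<sigma>\<^sup>2) + (1 / \<sigma>) *\<^sub>R z \<bullet> v
        = (norm v)\<^sup>2 / 2 + - (norm (z - \<sigma> *\<^sub>R v))\<^sup>2 / (2 * \<sigma>\<^sup>2)"
      using \<sigma> by (simp add: field_simps power2_eq_square)
    then have "exp (- (norm z)\<^sup>2 / (2 * \<sigma>\<^sup>2)) * exp ((1 / \<sigma>) *\<^sub>R z \<bullet> v)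
        = exp ((norm v)\<^sup>2 / 2) * exp (- (norm (z - \<sigma> *\<^sub>R v))\<^sup>2 / (2 * \<sigma>\<^sup>2))"
      by (metis exp_add)
    then show ?thesis by (simp add: iso_normal_density_def)
  qed
  have nonneg: "0 \<le> iso_normal_density \<mu> \<sigma> z" for \<mu> z :: "real^'n"
    by (simp add: iso_normal_density_def)
  have "(\<integral>\<^sup>+\<omega>. ennreal (exp ((1 / \<sigma>) *\<^sub>R \<xi> \<omega> \<bullet> v)) \<partial>P) = ennreal (exp ((norm v)\<^sup>2 / 2))" for v
  proof -
    have "(\<integral>\<^sup>+\<omega>. ennreal (exp ((1 / \<sigma>) *\<^sub>R \<xi> \<omega> \<bullet> v)) \<partial>P)
        = (\<integral>\<^sup>+z. ennreal (iso_normal_density 0 \<sigma> z) * ennreal (exp ((1 / \<sigma>) *\<^sub>R z \<bullet> v)) \<partial>lborel)"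
      by (rule distributed_nn_integral[OF D, symmetric]) measurable
    also have "\<dots> = (\<integral>\<^sup>+z. ennreal (exp ((norm v)\<^sup>2 / 2)) * ennreal (iso_normal_density (\<sigma> *\<^sub>R v) \<sigma> z) \<partial>lborel)"
      by (simp only: ennreal_mult'[symmetric] nonneg shift exp_ge_zero ennreal_mult''[symmetric])
    also have "\<dots> = ennreal (exp ((norm v)\<^sup>2 / 2))"
      by (subst nn_integral_cmult) (auto simp: mean)
    finally show ?thesis .
  qed
  then show ?thesis by (simp add: gaussian_mgf_def)
qed

lemma measure_mult_le_nn_integral:
  assumes "finite_measure P" "A \<in> sets P" "0 \<le> K" "0 \<le> B"
    and "\<And>\<omega>. \<omega> \<in> A \<Longrightarrow> ennreal K \<le> F \<omega>" and "(\<integral>\<^sup>+\<omega>. F \<omega> \<partial>P) \<le> ennreal B"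
  shows "K * measure P A \<le> B"
proof -
  interpret finite_measure P by fact
  have "ennreal (K * measure P A) = (\<integral>\<^sup>+\<omega>. ennreal K * indicator A \<omega> \<partial>P)"
    using assms by (simp add: nn_integral_cmult_indicator emeasure_eq_measure ennreal_mult')
  also have "\<dots> \<le> (\<integral>\<^sup>+\<omega>. F \<omega> \<partial>P)"
    using assms by (intro nn_integral_mono) (auto simp: indicator_def)
  also note assms(6)
  finally show ?thesis using assms(4) by simp
qed

text \<open>The union bound in exponential form: the largest of finitely many affine functions of \<open>g\<close> has
  an exponential at most the sum of their exponentials, so Markov's inequality at level \<open>K\<close> applies
  with the sum of the Gaussian moments.\<close>

lemma gaussian_max_tail:
  fixes g :: "'w \<Rightarrow> 'a::euclidean_space"
  assumes P: "prob_space P" and g: "gaussian_mgf P g" and A: "A \<in> sets P" and T: "finite T"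
    and hit: "\<And>\<omega>. \<omega> \<in> A \<Longrightarrow> \<exists>p\<in>T. K \<le> g \<omega> \<bullet> a p + c p"
    and B: "\<And>p. p \<in> T \<Longrightarrow> (norm (a p))\<^sup>2 / 2 + c p \<le> B"
  shows "measure P A \<le> card T * exp (B - K)"
proof -
  interpret prob_space P by fact
  have [measurable]: "g \<in> borel_measurable P" using g by (simp add: gaussian_mgf_def)
  have "exp K * measure P A \<le> card T * exp B"
  proof (rule measure_mult_le_nn_integral[where F = "\<lambda>\<omega>. \<Sum>p\<in>T. ennreal (exp (g \<omega> \<bullet> a p + c p))"])
    fix \<omega> assume "\<omega> \<in> A"
    then obtain p where p: "p \<in> T" "K \<le> g \<omega> \<bullet> a p + c p" using hit by blast
    have "ennreal (exp K) \<le> ennreal (exp (g \<omega> \<bullet> a p + c p))" using p by (simp add: ennreal_leI)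
    also have "\<dots> \<le> (\<Sum>p\<in>T. ennreal (exp (g \<omega> \<bullet> a p + c p)))"
      using p T by (intro member_le_sum) auto
    finally show "ennreal (exp K) \<le> (\<Sum>p\<in>T. ennreal (exp (g \<omega> \<bullet> a p + c p)))" .
  next
    have "(\<integral>\<^sup>+\<omega>. (\<Sum>p\<in>T. ennreal (exp (g \<omega> \<bullet> a p + c p))) \<partial>P)
        = (\<Sum>p\<in>T. ennreal (exp ((norm (a p))\<^sup>2 / 2 + c p)))"
      by (subst nn_integral_sum) (auto simp: gaussian_mgf_affine[OF g])
    also have "\<dots> \<le> (\<Sum>p\<in>T. ennreal (exp B))"
      using B by (intro sum_mono ennreal_leI) auto
    also have "\<dots> = ennreal (card T * exp B)"
      by (simp add: ennreal_mult' ennreal_of_nat_eq_real_of_nat)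
    finally show "(\<integral>\<^sup>+\<omega>. (\<Sum>p\<in>T. ennreal (exp (g \<omega> \<bullet> a p + c p))) \<partial>P) \<le> ennreal (card T * exp B)" .
  qed (use A in \<open>auto intro: finite_measure_axioms\<close>)
  then show ?thesis by (simp add: exp_diff field_simps)
qed

section \<open>Maurey's approximation for concave quadratics\<close>

text \<open>A linear functional on a convex hull is dominated by its value at some generator, because otherwise
  the hull would lie in an open half-space that misses \<open>u\<close>.\<close>

lemma hull_vertex_above:
  fixes d :: "'a::real_inner"
  assumes "u \<in> convex hull V"
  obtains v where "v \<in> V" "d \<bullet> u \<le> d \<bullet> v"
proof (rule ccontr)
  assume "\<not> thesis"
  then have "V \<subseteq> {v. d \<bullet> v < d \<bullet> u}" using that by force
  then have "convex hull V \<subseteq> {v. d \<bullet> v < d \<bullet> u}"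
    by (rule hull_minimal) (rule convex_halfspace_lt)
  then show False using assms by auto
qed

text \<open>In Maurey's argument \<open>v\<close> is drawn at random with mean \<open>u\<close>: the linear term vanishes on
  average and the variance is at most \<open>S\<^sup>2\<close>, so that some \<open>v\<close> does as well as the average.  Since
  \<open>\<parallel>v\<parallel> \<le> S\<close>, the quadratic term is itself bounded by an affine function of \<open>v\<close>, and a vertex
  at which that affine function is at least its value at \<open>u\<close> has the required property.\<close>

lemma maurey_step:
  fixes u :: "'a::real_inner"
  assumes u: "u \<in> convex hull V" and V: "\<And>v. v \<in> V \<Longrightarrow> norm v \<le> S" and e: "0 \<le> e"
  obtains v where "v \<in> V" "- e * S\<^sup>2 \<le> q \<bullet> (v - u) - e * (norm (v - u))\<^sup>2"
proof -
  obtain v where v: "v \<in> V" "(q + (2 * e) *\<^sub>R u) \<bullet> u \<le> (q + (2 * e) *\<^sub>R u) \<bullet> v"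
    using hull_vertex_above[OF u] .
  have "e * (norm v)\<^sup>2 \<le> e * S\<^sup>2" using V[OF v(1)] e by (intro mult_left_mono power_mono) auto
  moreover have "0 \<le> e * (u \<bullet> u)" using e by simp
  ultimately have "- e * S\<^sup>2 \<le> q \<bullet> (v - u) - e * (norm (v - u))\<^sup>2"
    using v(2) by (simp add: power2_norm_eq_inner inner_simps algebra_simps inner_commute)
  then show thesis using that v(1) by blast
qed

text \<open>Starting from \<open>u\<close>, seen as the average of \<open>k\<close> copies of itself, the copies are replaced one
  by one by vertices; by the previous lemma each replacement lowers \<open>F\<close> by at most
  \<open>c S\<^sup>2 / k\<^sup>2\<close>.  The approximating average depends on the linear part \<open>b\<close>, hence on the noise
  when this is applied, but it always belongs to the same finite family.\<close>

lemma maurey_quadratic: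
  fixes u w b :: "'a::real_inner"
  assumes u: "u \<in> convex hull V" and V: "\<And>v. v \<in> V \<Longrightarrow> norm v \<le> S" and c: "0 \<le> c" and k: "0 < k"
  defines "F \<equiv> \<lambda>p. b \<bullet> (p - w) - c * (norm (p - w))\<^sup>2"
  obtains N where "N \<in> multisets_of_size V k"
    "F u \<le> F ((1 / real k) *\<^sub>R sum_mset N) + c * S\<^sup>2 / real k"
proof -
  \<comment> \<open>\<open>Q j N\<close>: the average in which \<open>j\<close> of the \<open>k\<close> copies of \<open>u\<close> have been replaced by \<open>N\<close>.\<close>
  define Q where "Q j N = (1 / real k) *\<^sub>R (sum_mset N + (real k - real j) *\<^sub>R u)" for j N
  define e where "e = c / (real k)\<^sup>2"
  have "\<exists>N \<in> multisets_of_size V j. F u \<le> F (Q j N) + real j * (e * S\<^sup>2)" for j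
  proof (induction j)
    case 0
    have "Q 0 {#} = u" using k by (simp add: Q_def)
    then show ?case by simp
  next
    case (Suc j)
    then obtain N where N: "N \<in> multisets_of_size V j" "F u \<le> F (Q j N) + real j * (e * S\<^sup>2)" by blast
    define p where "p = Q j N"
    \<comment> \<open>\<open>q\<close> is the gradient of \<open>F\<close> at \<open>p\<close>, divided by \<open>k\<close> because a replacement moves the
      average by a \<open>k\<close>-th of \<open>v - u\<close>.\<close>
    define q where "q = (1 / real k) *\<^sub>R (b - (2 * c) *\<^sub>R (p - w))"
    obtain v where v: "v \<in> V" "- e * S\<^sup>2 \<le> q \<bullet> (v - u) - e * (norm (v - u))\<^sup>2"
      using maurey_step[OF u V, of e q] c by (auto simp: e_def)
    have "Q (Suc j) (add_mset v N) = p + (1 / real k) *\<^sub>R (v - u)"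
      using k by (simp add: Q_def p_def algebra_simps)
    moreover have "F (p + (1 / real k) *\<^sub>R (v - u)) = F p + (q \<bullet> (v - u) - e * (norm (v - u))\<^sup>2)"
    proof -
      have split: "F (p + t *\<^sub>R d) = F p + ((t *\<^sub>R (b - (2 * c) *\<^sub>R (p - w))) \<bullet> d - c * t\<^sup>2 * (norm d)\<^sup>2)" for t d
      proof -
        have expand: "(norm (p + t *\<^sub>R d - w))\<^sup>2 = (norm (p - w))\<^sup>2 + 2 * t * ((p - w) \<bullet> d) + t\<^sup>2 * (norm d)\<^sup>2"
          unfolding power2_norm_eq_inner by (simp add: inner_simps algebra_simps inner_commute power2_eq_square)
        show ?thesis
          unfolding F_def expand by (simp add: inner_simps algebra_simps)
      qed
      show ?thesis
        by (simp only: split q_def e_def power_divide) (simp add: power2_eq_square)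
    qed
    ultimately have "F (Q (Suc j) (add_mset v N)) = F p + (q \<bullet> (v - u) - e * (norm (v - u))\<^sup>2)" by simp
    moreover have "F u \<le> F p + real j * (e * S\<^sup>2)" using N(2) by (simp add: p_def)
    moreover have "real (Suc j) * (e * S\<^sup>2) = real j * (e * S\<^sup>2) + e * S\<^sup>2" by (simp add: algebra_simps)
    ultimately have "F u \<le> F (Q (Suc j) (add_mset v N)) + real (Suc j) * (e * S\<^sup>2)"
      using v(2) by simp
    moreover have "add_mset v N \<in> multisets_of_size V (Suc j)"
      using v(1) N(1) by (auto simp: multisets_of_size_def)
    ultimately show ?case by blast
  qed
  then obtain N where N: "N \<in> multisets_of_size V k" "F u \<le> F (Q k N) + real k * (e * S\<^sup>2)" by blast
  have "real k * (e * S\<^sup>2) = c * S\<^sup>2 / real k" using k by (simp add: e_def power2_eq_square)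
  then show thesis using that[OF N(1)] N(2) by (simp add: Q_def)
qed

lemma power_le_exp_fact: "real k ^ k \<le> exp (real k) * fact k"
proof -
  have "real k ^ k / fact k \<le> (\<Sum>j\<le>k. real k ^ j / fact j)"
    by (rule member_le_sum) auto
  also have "\<dots> \<le> exp (real k)"
    using sum_le_suminf[OF summable_exp_generic[of "real k"], of "{..k}"]
    by (simp add: exp_def divide_inverse mult.commute scaleR_conv_of_real)
  finally show ?thesis by (simp add: divide_le_eq)
qed

text \<open>Averages of \<open>k\<close> vertices do not depend on the order of the vertices.  The factor \<open>k!\<close> gained by
  counting multisets instead of sequences turns \<open>ln (2 M)\<close> into about \<open>ln (2 e M / k)\<close>, which is why the
  logarithm in the rate has \<open>R sqrt n\<close> in its denominator.\<close>

lemma card_multisets_le: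
  assumes "finite V" "0 < k"
  shows "real (card (multisets_of_size V k)) \<le> (exp 1 * (1 + real (card V) / real k)) ^ k"
proof -
  let ?C = "(card V + k - 1) choose k"
  have "?C * fact k \<le> (card V + k - 1) ^ k" by (rule binomial_fact_pow)
  also have "\<dots> \<le> (card V + k) ^ k" by (rule power_mono) auto
  finally have *: "real ?C * fact k \<le> real (card V + k) ^ k"
    by (metis of_nat_fact of_nat_le_iff of_nat_mult of_nat_power)
  have "real ?C * real k ^ k \<le> real ?C * (exp (real k) * fact k)"
    by (intro mult_left_mono power_le_exp_fact) auto
  also have "\<dots> \<le> exp (real k) * real (card V + k) ^ k"
    using * by (simp add: mult.left_commute)
  finally have "real ?C \<le> exp (real k) * (real (card V + k) / real k) ^ k"
    using assms(2) by (simp add: power_divide field_simps)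
  also have "\<dots> = (exp 1 * (1 + real (card V) / real k)) ^ k"
    using assms(2) by (simp add: power_mult_distrib exp_of_nat_mult[symmetric] add_divide_distrib add.commute)
  finally show ?thesis using assms(1) by (simp add: card_multisets_of_size)
qed

section \<open>Gaussian tails over a convex hull\<close>

text \<open>The estimate behind the \<open>\<ell>\<^sub>1\<close> term of the rate.  Two regimes occur because Maurey's argument
  needs at least one vertex: the optimal number \<open>k\<close> of vertices is about \<open>S / sqrt L\<close>.  If
  this is at least \<open>1\<close>, approximation and counting together cost at most \<open>5 S sqrt L\<close> in the
  exponent, out of the \<open>31 S sqrt L\<close> that the threshold provides.\<close>

lemma gaussian_hull_tail:
  fixes g :: "'w \<Rightarrow> 'a::euclidean_space"
  assumes P: "prob_space P" and g: "gaussian_mgf P g" and A: "A \<in> sets P" and V: "finite V"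
    and S: "0 < S" and bound: "\<And>v. v \<in> V \<Longrightarrow> norm v \<le> S" and w: "norm w \<le> S"
    and L: "1 \<le> L" "exp 1 * card V / S \<le> exp L" and x: "0 < x"
    and hit: "\<And>\<omega>. \<omega> \<in> A \<Longrightarrow> \<exists>u\<in>convex hull V.
       124 * S * sqrt L + 4 * x < 2 * (g \<omega> \<bullet> (u - w)) - (norm (u - w))\<^sup>2"
  shows "measure P A < exp (- x)"
proof -
  have sL: "0 < sqrt L" "sqrt L * sqrt L = L" "1 \<le> sqrt L" using L by auto
  have sL_le: "sqrt L \<le> L" using mult_left_mono[OF sL(3), of "sqrt L"] sL by simp
  have "0 < S * sqrt L" using S sL by simp
  have Lexp: "1 + L \<le> exp L" by (rule exp_ge_add_one_self)
  show ?thesis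
  proof (cases "S < sqrt L")
    case True
    \<comment> \<open>The exponent \<open>l \<ge> 1\<close> balances the variance of the functional at the vertices, of order
      \<open>l\<^sup>2 S\<^sup>2 = L\<close>, with the logarithm of their number, which is at most \<open>2 L\<close>; since \<open>l x \<ge> x\<close>,
      the deviation term only improves.\<close>
    define l where "l = sqrt L / S"
    have l: "1 \<le> l" "0 < l" using True S sL by (simp_all add: l_def del: real_sqrt_gt_0_iff)
    have "measure P A \<le> card V * exp (L / 2 - (31 * L + l * x))"
    proof (rule gaussian_max_tail[OF P g A V, where a = "\<lambda>v. (l / 2) *\<^sub>R (v - w)" and c = "\<lambda>_. 0"])
      fix \<omega> assume "\<omega> \<in> A"
      then obtain u where u: "u \<in> convex hull V"
        "124 * S * sqrt L + 4 * x < 2 * (g \<omega> \<bullet> (u - w)) - (norm (u - w))\<^sup>2" using hit by blast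
      obtain v where v: "v \<in> V" "g \<omega> \<bullet> u \<le> g \<omega> \<bullet> v" using hull_vertex_above[OF u(1)] .
      have "124 * S * sqrt L + 4 * x < 2 * (g \<omega> \<bullet> (u - w))"
        by (rule order_less_le_trans[OF u(2)]) simp
      then have "62 * (S * sqrt L) + 2 * x \<le> g \<omega> \<bullet> (v - w)"
        using v(2) by (simp add: inner_diff_right)
      then have "31 * S * sqrt L + x \<le> g \<omega> \<bullet> (v - w) / 2" by simp
      then have "l * (31 * S * sqrt L + x) \<le> l * (g \<omega> \<bullet> (v - w) / 2)"
        using l by (intro mult_left_mono) auto
      moreover have "l * (31 * S * sqrt L) = 31 * L" using S sL by (simp add: l_def)
      ultimately show "\<exists>v\<in>V. 31 * L + l * x \<le> g \<omega> \<bullet> (l / 2) *\<^sub>R (v - w) + 0"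
        using v(1) by (intro bexI[of _ v]) (auto simp: distrib_left)
    next
      fix v assume "v \<in> V"
      then have "norm (v - w) \<le> 2 * S" using norm_triangle_ineq4[of v w] bound[of v] w by simp
      then have "(norm (v - w))\<^sup>2 \<le> (2 * S)\<^sup>2" by (intro power_mono) auto
      then have "l\<^sup>2 * (norm (v - w))\<^sup>2 \<le> l\<^sup>2 * (2 * S)\<^sup>2" by (intro mult_left_mono) auto
      also have "\<dots> = 4 * L" using S sL by (simp add: l_def power2_eq_square)
      finally show "(norm ((l / 2) *\<^sub>R (v - w)))\<^sup>2 / 2 + 0 \<le> L / 2"
        by (simp add: power_mult_distrib power_divide)
    qed
    \<comment> \<open>Here \<open>S < sqrt L \<le> exp L\<close> absorbs the missing factor \<open>S\<close> in the hypothesis on \<open>L\<close>.\<close>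
    moreover have "real (card V) \<le> exp (2 * L)"
    proof -
      have "1 * real (card V) \<le> exp 1 * real (card V)" by (intro mult_right_mono) auto
      then have "real (card V) \<le> exp 1 * card V" by simp
      also have "\<dots> \<le> exp L * S" using L S by (simp add: divide_le_eq)
      also have "S \<le> exp L" using True sL_le Lexp by linarith
      finally have "real (card V) \<le> exp L * exp L" by simp
      then show ?thesis by (simp add: exp_add[symmetric])
    qed
    ultimately have "measure P A \<le> exp (2 * L) * exp (L / 2 - (31 * L + l * x))"
      by (meson exp_ge_zero mult_right_mono order_trans)
    also have "\<dots> < exp (- x)"
    proof -
      have "1 * x \<le> l * x" using l x by (intro mult_right_mono) auto
      then show ?thesis using L by (simp add: exp_add[symmetric])
    qed
    finally show ?thesis .
  next
    case False
    \<comment> \<open>Rounding up costs at most a factor \<open>2\<close> because \<open>S / sqrt L \<ge> 1\<close>.\<close>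
    define k where "k = nat \<lceil>S / sqrt L\<rceil>"
    have one: "1 \<le> S / sqrt L" using False sL by simp
    have k: "S / sqrt L \<le> real k" "real k \<le> 2 * (S / sqrt L)" "0 < k"
      using one unfolding k_def by linarith+
    define T where "T = (\<lambda>N. (1 / real k) *\<^sub>R sum_mset N) ` multisets_of_size V k"
    have T: "finite T" unfolding T_def using V by auto
    have "measure P A \<le> card T * exp (0 - (31 * S * sqrt L + x - S\<^sup>2 / (4 * real k)))"
    proof (rule gaussian_max_tail[OF P g A T,
          where a = "\<lambda>p. (1 / 2) *\<^sub>R (p - w)" and c = "\<lambda>p. - (norm (p - w))\<^sup>2 / 4"])
      fix \<omega> assume "\<omega> \<in> A"
      then obtain u where u: "u \<in> convex hull V"
        "124 * S * sqrt L + 4 * x < 2 * (g \<omega> \<bullet> (u - w)) - (norm (u - w))\<^sup>2" using hit by blast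
      obtain N where N: "N \<in> multisets_of_size V k"
        "((1/2) *\<^sub>R g \<omega>) \<bullet> (u - w) - (1/4) * (norm (u - w))\<^sup>2
          \<le> ((1/2) *\<^sub>R g \<omega>) \<bullet> ((1 / real k) *\<^sub>R sum_mset N - w)
              - (1/4) * (norm ((1 / real k) *\<^sub>R sum_mset N - w))\<^sup>2 + (1/4) * S\<^sup>2 / real k"
        using maurey_quadratic[OF u(1) bound, of "1/4" k "(1/2) *\<^sub>R g \<omega>" w] k(3) by auto
      show "\<exists>p\<in>T. 31 * S * sqrt L + x - S\<^sup>2 / (4 * real k)
              \<le> g \<omega> \<bullet> (1 / 2) *\<^sub>R (p - w) + - (norm (p - w))\<^sup>2 / 4"
        unfolding T_def
        by (rule bexI[OF _ imageI[OF N(1)]]) (use u(2) N(2) in simp)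
    next
      fix p
      show "(norm ((1 / 2) *\<^sub>R (p - w)))\<^sup>2 / 2 + - (norm (p - w))\<^sup>2 / 4 \<le> 0"
        by (simp add: power_divide)
    qed
    moreover have "real (card T) \<le> exp (4 * (S * sqrt L))"
    proof -
      have "real (card T) \<le> real (card (multisets_of_size V k))"
        unfolding T_def using V by (simp add: card_image_le finite_multisets_of_size)
      also have "\<dots> \<le> (exp 1 * (1 + real (card V) / real k)) ^ k"
        by (rule card_multisets_le[OF V k(3)])
      also have "\<dots> \<le> exp (2 * L) ^ k"
      proof (rule power_mono)
        have "exp 1 * card V \<le> exp L * S" using L S by (simp add: divide_le_eq)
        also have "\<dots> \<le> exp L * (real k * sqrt L)"
          using k(1) sL by (simp add: divide_le_eq)
        finally have "exp 1 * (real (card V) / real k) \<le> exp L * sqrt L"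
          using k(3) by (simp add: divide_le_eq mult_ac)
        moreover have "exp 1 \<le> exp L" using L by simp
        moreover have "exp L * sqrt L \<le> exp L * L" using sL_le by simp
        moreover have "exp L * (1 + L) \<le> exp L * exp L" using Lexp by simp
        moreover have "exp L * exp L = exp (2 * L)" by (simp add: exp_add[symmetric])
        ultimately show "exp 1 * (1 + real (card V) / real k) \<le> exp (2 * L)"
          by (simp only: distrib_left)
      qed simp
      also have "\<dots> = exp (real k * (2 * L))" by (simp add: exp_of_nat_mult)
      also have "real k * (2 * L) \<le> 2 * (S / sqrt L) * (2 * L)"
        using k(2) L by (intro mult_right_mono) auto
      also have "2 * (S / sqrt L) * (2 * L) = 4 * (S * sqrt L)"
        using sL by (simp add: field_simps)
      finally show ?thesis by simp
    qed
    moreover have "S\<^sup>2 / (4 * real k) \<le> S * sqrt L"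
    proof -
      have "S \<le> sqrt L * real k" using k(1) sL by (simp add: divide_le_eq mult.commute)
      then have "S * S \<le> S * (sqrt L * real k)" using S by simp
      moreover have "0 \<le> S * (sqrt L * real k)" using S sL by simp
      ultimately have "S * S \<le> 4 * (S * (sqrt L * real k))" by linarith
      then show ?thesis using k(3) by (simp add: divide_le_eq power2_eq_square mult_ac)
    qed
    ultimately have "measure P A \<le> exp (4 * (S * sqrt L)) * exp (0 - (31 * S * sqrt L + x - S * sqrt L))"
      by (smt (verit) exp_ge_zero exp_le_cancel_iff mult_mono of_nat_0_le_iff)
    also have "\<dots> < exp (- x)"
      using \<open>0 < S * sqrt L\<close> by (simp add: exp_add[symmetric])
    finally show ?thesis .
  qed
qed

section \<open>Chi-square moments and Gaussian tails over a subspace\<close>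

lemma nn_integral_std_normal_exp_linear:
  "(\<integral>\<^sup>+s. ennreal (exp (c * s)) \<partial>density lborel (normal_density 0 1)) = ennreal (exp (c\<^sup>2 / 2))"
proof -
  have shift: "std_normal_density s * exp (c * s) = exp (c\<^sup>2 / 2) * normal_density c 1 s" for s
    by (simp add: normal_density_def exp_add[symmetric] power2_eq_square field_simps)
  interpret N: prob_space "density lborel (normal_density c 1)"
    by (rule prob_space_normal_density) simp
  have "(\<integral>\<^sup>+s. ennreal (exp (c * s)) \<partial>density lborel (normal_density 0 1))
      = (\<integral>\<^sup>+s. ennreal (exp (c\<^sup>2 / 2)) * ennreal (normal_density c 1 s) \<partial>lborel)"
    by (simp add: nn_integral_density ennreal_mult'[symmetric] shift)
  also have "\<dots> = ennreal (exp (c\<^sup>2 / 2)) * emeasure (density lborel (normal_density c 1)) UNIV"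
    by (simp add: nn_integral_cmult emeasure_density)
  finally show ?thesis using N.emeasure_space_1 by simp
qed

lemma nn_integral_std_normal_exp_quadratic:
  "(\<integral>\<^sup>+s. ennreal (exp (s\<^sup>2 / 4)) \<partial>density lborel (normal_density 0 1)) = ennreal (sqrt 2)"
proof -
  have widen: "std_normal_density s * exp (s\<^sup>2 / 4) = sqrt 2 * normal_density 0 (sqrt 2) s" for s
    by (simp add: normal_density_def exp_add[symmetric] real_sqrt_mult field_simps)
  interpret N: prob_space "density lborel (normal_density 0 (sqrt 2))"
    by (rule prob_space_normal_density) simp
  have "(\<integral>\<^sup>+s. ennreal (exp (s\<^sup>2 / 4)) \<partial>density lborel (normal_density 0 1))
      = (\<integral>\<^sup>+s. ennreal (sqrt 2) * ennreal (normal_density 0 (sqrt 2) s) \<partial>lborel)"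
    by (simp add: nn_integral_density ennreal_mult'[symmetric] widen)
  also have "\<dots> = ennreal (sqrt 2) * emeasure (density lborel (normal_density 0 (sqrt 2))) UNIV"
    by (simp add: nn_integral_cmult emeasure_density)
  finally show ?thesis using N.emeasure_space_1 by simp
qed

text \<open>The chi-square moment \<open>E exp (Q / 4) = 2 powr (r / 2)\<close> for \<open>Q\<close> a sum of \<open>r\<close> squared coordinates,
  without rotating the space: each factor \<open>exp (t\<^sup>2 / 4)\<close> is written as the moment generating function
  of an auxiliary standard normal \<open>s\<close> at \<open>t / sqrt 2\<close>.  This makes the exponent linear in \<open>g\<close>,
  and after exchanging the integrals only the scalar moment \<open>E exp (s\<^sup>2 / 4) = sqrt 2\<close> remains.  The
  extra linear term \<open>g \<bullet> v\<close> is what makes the induction go through.\<close>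

lemma gaussian_mgf_squares:
  fixes g :: "'w \<Rightarrow> 'a::euclidean_space"
  assumes P: "prob_space P" and g: "gaussian_mgf P g" and "finite B"
    and "pairwise orthogonal B" and "\<And>b. b \<in> B \<Longrightarrow> norm b = 1" and "\<And>b. b \<in> B \<Longrightarrow> v \<bullet> b = 0"
  shows "(\<integral>\<^sup>+\<omega>. ennreal (exp ((\<Sum>b\<in>B. (g \<omega> \<bullet> b)\<^sup>2) / 4 + g \<omega> \<bullet> v)) \<partial>P)
      = ennreal (sqrt 2 ^ card B * exp ((norm v)\<^sup>2 / 2))"
  using assms(3-6)
proof (induction B arbitrary: v rule: finite_induct)
  case empty
  then show ?case using gaussian_mgf_affine[OF g, of v 0] by simp
next
  case (insert b B)
  let ?N = "density lborel (\<lambda>s. ennreal (std_normal_density s))"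
  interpret prob_space P by fact
  interpret N: prob_space ?N by (rule prob_space_normal_density) simp
  interpret pair_sigma_finite ?N P by unfold_locales
  have [measurable]: "g \<in> borel_measurable P" using g by (simp add: gaussian_mgf_def)
  define Z where "Z \<omega> = (\<Sum>b\<in>B. (g \<omega> \<bullet> b)\<^sup>2) / 4 + g \<omega> \<bullet> v" for \<omega>
  define v' where "v' s = v + (s / sqrt 2) *\<^sub>R b" for s
  have [measurable]: "Z \<in> borel_measurable P" unfolding Z_def by measurable
  have orth: "b' \<bullet> b = 0" if "b' \<in> B" for b'
    using insert.prems(1) insert.hyps that by (auto simp: pairwise_insert orthogonal_def inner_commute)
  have v'_orth: "v' s \<bullet> b' = 0" if "b' \<in> B" for s b'
    using insert.prems(3)[of b'] orth[OF that] that by (simp add: v'_def inner_simps inner_commute)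
  have v'_norm: "(norm (v' s))\<^sup>2 / 2 = (norm v)\<^sup>2 / 2 + s\<^sup>2 / 4" for s
  proof -
    have "b \<bullet> b = 1" using insert.prems(2)[of b] by (simp add: norm_eq_1)
    moreover have "v \<bullet> b = 0" using insert.prems(3) by simp
    ultimately show ?thesis
      unfolding power2_norm_eq_inner by (simp add: v'_def inner_simps inner_commute power2_eq_square)
  qed
  have "(\<integral>\<^sup>+\<omega>. ennreal (exp ((\<Sum>b\<in>insert b B. (g \<omega> \<bullet> b)\<^sup>2) / 4 + g \<omega> \<bullet> v)) \<partial>P)
      = (\<integral>\<^sup>+\<omega>. ennreal (exp (Z \<omega>)) * ennreal (exp (((g \<omega> \<bullet> b) / sqrt 2)\<^sup>2 / 2)) \<partial>P)"
    using insert.hyps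
    by (intro nn_integral_cong)
       (simp add: Z_def ennreal_mult'[symmetric] exp_add[symmetric] power_divide add_divide_distrib algebra_simps)
  also have "\<dots> = (\<integral>\<^sup>+\<omega>. (\<integral>\<^sup>+s. ennreal (exp (Z \<omega>)) * ennreal (exp ((g \<omega> \<bullet> b) / sqrt 2 * s)) \<partial>?N) \<partial>P)"
    by (subst nn_integral_cmult) (simp_all only: nn_integral_std_normal_exp_linear, measurable)
  also have "\<dots> = (\<integral>\<^sup>+s. (\<integral>\<^sup>+\<omega>. ennreal (exp (Z \<omega>)) * ennreal (exp ((g \<omega> \<bullet> b) / sqrt 2 * s)) \<partial>P) \<partial>?N)"
    by (rule Fubini') measurable
  also have "\<dots> = (\<integral>\<^sup>+s. (\<integral>\<^sup>+\<omega>. ennreal (exp ((\<Sum>b\<in>B. (g \<omega> \<bullet> b)\<^sup>2) / 4 + g \<omega> \<bullet> v' s)) \<partial>P) \<partial>?N)"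
    by (simp add: Z_def v'_def ennreal_mult'[symmetric] exp_add[symmetric] inner_simps algebra_simps)
  also have "\<dots> = (\<integral>\<^sup>+s. ennreal (sqrt 2 ^ card B * exp ((norm (v' s))\<^sup>2 / 2)) \<partial>?N)"
    using insert.prems(1,2) v'_orth by (subst insert.IH) (auto simp: pairwise_insert)
  also have "\<dots> = (\<integral>\<^sup>+s. ennreal (sqrt 2 ^ card B * exp ((norm v)\<^sup>2 / 2)) * ennreal (exp (s\<^sup>2 / 4)) \<partial>?N)"
    by (simp add: v'_norm exp_add ennreal_mult' mult.assoc)
  also have "\<dots> = ennreal (sqrt 2 ^ card B * exp ((norm v)\<^sup>2 / 2)) * ennreal (sqrt 2)"
    by (subst nn_integral_cmult) (auto simp: nn_integral_std_normal_exp_quadratic)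
  finally show ?case using insert.hyps by (simp add: ennreal_mult'[symmetric] mult_ac)
qed

text \<open>Completing the square coordinatewise in an orthonormal basis bounds the supremum over the
  subspace by the chi-square variable with \<open>dim W\<close> degrees of freedom.  Strictness of the tail
  comes from \<open>sqrt 2 < exp 2\<close>, which gains something only in positive dimension; in dimension
  \<open>0\<close> the event is empty.\<close>

lemma gaussian_subspace_tail:
  fixes g :: "'w \<Rightarrow> 'a::euclidean_space"
  assumes P: "prob_space P" and g: "gaussian_mgf P g" and A: "A \<in> sets P" and W: "subspace W"
    and x: "0 < x"
    and hit: "\<And>\<omega>. \<omega> \<in> A \<Longrightarrow> \<exists>h\<in>W. 8 * real (dim W) + 4 * x < 2 * (g \<omega> \<bullet> h) - (norm h)\<^sup>2"
  shows "measure P A < exp (- x)"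
proof (cases "dim W = 0")
  case True
  then have "A = {}" using hit x by (fastforce simp: dim_eq_0)
  then show ?thesis by simp
next
  case False
  interpret prob_space P by fact
  obtain B where B: "B \<subseteq> W" "pairwise orthogonal B" "\<And>b. b \<in> B \<Longrightarrow> norm b = 1"
      "independent B" "card B = dim W" "span B = W"
    using orthonormal_basis_subspace[OF W] by metis
  have fin: "finite B" using B(4) independent_imp_finite by blast
  let ?r = "dim W"
  have "exp (2 * real ?r + x) * measure P A \<le> sqrt 2 ^ ?r"
  proof (rule measure_mult_le_nn_integral[where F = "\<lambda>\<omega>. ennreal (exp ((\<Sum>b\<in>B. (g \<omega> \<bullet> b)\<^sup>2) / 4))"])
    fix \<omega> assume "\<omega> \<in> A"
    then obtain h where h: "h \<in> W" "8 * real ?r + 4 * x < 2 * (g \<omega> \<bullet> h) - (norm h)\<^sup>2" using hit by blast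
    from h(1) obtain c where c: "h = (\<Sum>b\<in>B. c b *\<^sub>R b)" using B(6) fin by (auto simp: span_finite)
    have "(norm h)\<^sup>2 = (\<Sum>b\<in>B. (norm (c b *\<^sub>R b))\<^sup>2)"
      unfolding c using B(2) fin
      by (intro norm_sum_Pythagorean) (auto simp: pairwise_def orthogonal_def)
    also have "\<dots> = (\<Sum>b\<in>B. (c b)\<^sup>2)" using B(3) by (intro sum.cong) (auto simp: power_mult_distrib)
    finally have "2 * (g \<omega> \<bullet> h) - (norm h)\<^sup>2 = (\<Sum>b\<in>B. 2 * (c b * (g \<omega> \<bullet> b)) - (c b)\<^sup>2)"
      by (simp add: c inner_sum_right sum_subtractf sum_distrib_left)
    also have "\<dots> \<le> (\<Sum>b\<in>B. (g \<omega> \<bullet> b)\<^sup>2)"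
    proof (rule sum_mono)
      fix b
      show "2 * (c b * (g \<omega> \<bullet> b)) - (c b)\<^sup>2 \<le> (g \<omega> \<bullet> b)\<^sup>2"
        using zero_le_power2[of "g \<omega> \<bullet> b - c b"] by (simp add: power2_diff algebra_simps)
    qed
    finally show "ennreal (exp (2 * real ?r + x)) \<le> ennreal (exp ((\<Sum>b\<in>B. (g \<omega> \<bullet> b)\<^sup>2) / 4))"
      using h(2) by (intro ennreal_leI) simp
  next
    show "(\<integral>\<^sup>+\<omega>. ennreal (exp ((\<Sum>b\<in>B. (g \<omega> \<bullet> b)\<^sup>2) / 4)) \<partial>P) \<le> ennreal (sqrt 2 ^ ?r)"
      using gaussian_mgf_squares[OF P g fin B(2,3), of 0] B(5) by simp
  qed (use A in \<open>auto intro: finite_measure_axioms\<close>)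
  also have "sqrt 2 ^ ?r < exp 2 ^ ?r"
  proof (rule power_strict_mono)
    have "sqrt 2 < (2::real)" by (rule real_less_lsqrt) auto
    also have "2 < exp (2::real)" using exp_ge_add_one_self[of 2] by simp
    finally show "sqrt 2 < exp (2::real)" .
  qed (use False in auto)
  also have "exp 2 ^ ?r = exp (2 * real ?r + x) * exp (- x)"
    by (simp add: exp_of_nat_mult[symmetric] exp_add[symmetric] mult.commute)
  finally show ?thesis by simp
qed

section \<open>Geometry of the constrained least squares problem\<close>

text \<open>The term \<open>- \<parallel>v - u\<parallel>\<^sup>2\<close> comes from convexity of \<open>C\<close>; comparing the values of the objective
  at \<open>u\<close> and \<open>v\<close> alone would not produce it.\<close>

lemma projection_basic_inequality:
  fixes f0 \<xi> u v :: "'a::real_inner"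
  assumes "convex C" "closed C" "v \<in> C" "u \<in> C" "\<forall>z\<in>C. dist (f0 + \<xi>) v \<le> dist (f0 + \<xi>) z"
  shows "(norm (v - f0))\<^sup>2 \<le> (norm (u - f0))\<^sup>2 + 2 * (\<xi> \<bullet> (v - u)) - (norm (v - u))\<^sup>2"
  using any_closest_point_dot[OF assms]
  unfolding power2_norm_eq_inner by (simp add: inner_simps algebra_simps inner_commute)

text \<open>The signs of the coefficients select one of each pair of opposite vectors, and the weight missing
  to a total of \<open>1\<close> is put on the origin, which lies in the symmetric hull.\<close>

lemma sum_in_symmetric_hull:
  fixes a :: "'m::finite \<Rightarrow> 'a::real_vector"
  assumes "(\<Sum>j\<in>UNIV. \<bar>c j\<bar>) \<le> 1"
  shows "(\<Sum>j\<in>UNIV. c j *\<^sub>R a j) \<in> convex hull (range a \<union> range (\<lambda>j. - a j))" (is "_ \<in> ?H")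
proof -
  define s where "s = (\<Sum>j\<in>UNIV. \<bar>c j\<bar>)"
  have H: "convex ?H" by (rule convex_convex_hull)
  have ends: "a j \<in> ?H" "- a j \<in> ?H" for j by (auto intro: hull_inc)
  have zero: "0 \<in> ?H"
    using convexD[OF H ends, of "1/2" "1/2" undefined undefined] by simp
  have sg: "sgn (c j) *\<^sub>R a j \<in> ?H" for j
    using ends[of j] zero by (auto simp: sgn_real_def)
  show ?thesis
  proof (cases "s = 0")
    case True
    then have "c j = 0" for j by (simp add: s_def sum_nonneg_eq_0_iff)
    then show ?thesis using zero by simp
  next
    case False
    have "0 \<le> s" by (simp add: s_def sum_nonneg)
    with False have "0 < s" by simp
    moreover have "s \<le> 1" using assms by (simp add: s_def)
    ultimately have s: "0 < s" "s \<le> 1" .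
    have "(\<Sum>j\<in>UNIV. (\<bar>c j\<bar> / s) *\<^sub>R (sgn (c j) *\<^sub>R a j)) \<in> ?H"
      using s by (intro convex_sum H sg) (auto simp: sum_divide_distrib[symmetric] s_def[symmetric])
    then have "s *\<^sub>R (\<Sum>j\<in>UNIV. (\<bar>c j\<bar> / s) *\<^sub>R (sgn (c j) *\<^sub>R a j)) + (1 - s) *\<^sub>R 0 \<in> ?H"
      using s zero by (intro convexD[OF H]) auto
    then show ?thesis using s by (simp add: scaleR_sum_right mult.commute[of "\<bar>_\<bar>"] sgn_mult_abs)
  qed
qed

lemma convex_l1_ball: "convex {\<beta>::real^'m. l1_norm \<beta> \<le> R}"
proof (rule convexI, clarify)
  fix a b :: "real^'m" and s t :: real
  assume a: "l1_norm a \<le> R" and b: "l1_norm b \<le> R" and st: "0 \<le> s" "0 \<le> t" "s + t = 1"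
  have "l1_norm (s *\<^sub>R a + t *\<^sub>R b) \<le> s * l1_norm a + t * l1_norm b"
    unfolding l1_norm_def sum_distrib_left sum.distrib[symmetric] using st
    by (intro sum_mono) (auto simp: abs_mult intro!: order_trans[OF abs_triangle_ineq])
  also have "\<dots> \<le> R" using a b st by (intro convex_bound_le)
  finally show "l1_norm (s *\<^sub>R a + t *\<^sub>R b) \<le> R" .
qed

lemma compact_l1_ball: "compact {\<beta>::real^'m. l1_norm \<beta> \<le> R}"
proof -
  have "closed {\<beta>::real^'m. l1_norm \<beta> \<le> R}"
    unfolding l1_norm_def by (intro closed_Collect_le continuous_intros)
  moreover have "bounded {\<beta>::real^'m. l1_norm \<beta> \<le> R}"
    by (rule boundedI[of _ R]) (use norm_le_l1_cart in \<open>force simp: l1_norm_def intro: order_trans\<close>)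
  ultimately show ?thesis by (simp add: compact_eq_bounded_closed)
qed

text \<open>The factor \<open>t\<close> allows the rescaling of the noise to standard deviation \<open>1\<close>.\<close>

lemma l1_ball_image_in_hull:
  fixes X :: "real^'m^'n"
  assumes "0 < R" "l1_norm \<beta> \<le> R"
  shows "t *\<^sub>R (X *v \<beta>)
    \<in> convex hull (range (\<lambda>j. (t * R) *\<^sub>R column j X) \<union> range (\<lambda>j. - ((t * R) *\<^sub>R column j X)))"
proof -
  have "(\<Sum>j\<in>UNIV. \<bar>\<beta> $ j / R\<bar>) \<le> 1"
    using assms by (simp add: l1_norm_def sum_divide_distrib[symmetric])
  from sum_in_symmetric_hull[OF this, of "\<lambda>j. (t * R) *\<^sub>R column j X"] show ?thesis
    using assms by (simp add: matrix_mult_sum scalar_mult_eq_scaleR scaleR_sum_right mult.commute)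
qed

section \<open>The oracle inequality\<close>

theorem theorem7:
  fixes P :: "'w measure"
    and \<xi> y :: "'w \<Rightarrow> real^'n"
    and f0 :: "real^'n"
    and X :: "real^'m^'n"
    and \<beta>hat :: "'w \<Rightarrow> real^'m"
    and \<sigma> R x :: real
  assumes "prob_space P"
    and "\<sigma> > 0" and "R > 0"
    and "distributed P lborel \<xi> (\<lambda>z. ennreal (iso_normal_density 0 \<sigma> z))"
    and "\<And>\<omega>. \<omega> \<in> space P \<Longrightarrow> y \<omega> = f0 + \<xi> \<omega>"
    and "\<And>j. 1 / real CARD('n) * (norm (column j X))\<^sup>2 \<le> 1"
    and "\<And>\<omega>. \<omega> \<in> space P \<Longrightarrow>
           is_arg_min (\<lambda>\<beta>. (norm (y \<omega> - X *v \<beta>))\<^sup>2) (\<lambda>\<beta>. l1_norm \<beta> \<le> R) (\<beta>hat \<omega>)"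
    and "x > 0"
  shows "measure P {\<omega> \<in> space P.
           1 / real CARD('n) * (norm (X *v \<beta>hat \<omega> - f0))\<^sup>2
             \<le> (INF \<beta>\<in>{\<beta>. l1_norm \<beta> \<le> R}. 1 / real CARD('n) * (norm (X *v \<beta> - f0))\<^sup>2)
               + 2 * lasso_rate \<sigma> R X + 4 * \<sigma>\<^sup>2 * x / real CARD('n)}
         > 1 - exp (- x)"
proof -
  interpret prob_space P by fact
  note \<sigma> = assms(2) and R = assms(3)
  define n where "n = real CARD('n)"
  have n: "0 < n" by (simp add: n_def)
  define D where "D = {\<beta>::real^'m. l1_norm \<beta> \<le> R}"
  define C where "C = (\<lambda>\<beta>. X *v \<beta>) ` D"
  have D0: "0 \<in> D" using R by (simp add: D_def l1_norm_def)
  have lin: "linear (\<lambda>\<beta>. X *v \<beta>)" by (rule matrix_vector_mul_linear)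
  have C: "convex C" "closed C" "C \<noteq> {}"
    using convex_linear_image[OF lin convex_l1_ball[of R]]
      compact_continuous_image[OF linear_continuous_on[OF linear_conv_bounded_linear[THEN iffD1, OF lin]] compact_l1_ball[of R]] D0
    by (auto simp: C_def D_def intro: compact_imp_closed)
  define fit where "fit \<omega> = X *v \<beta>hat \<omega>" for \<omega>
  define u where "u = closest_point C f0"
  have uC: "u \<in> C" using closest_point_in_set[OF C(2,3)] by (simp add: u_def)
  have fit: "fit \<omega> \<in> C" "\<forall>z\<in>C. dist (f0 + \<xi> \<omega>) (fit \<omega>) \<le> dist (f0 + \<xi> \<omega>) z" if "\<omega> \<in> space P" for \<omega>
    using assms(7)[OF that] assms(5)[OF that]
    by (auto simp: is_arg_min_def fit_def C_def D_def dist_norm not_less power_mono_iff)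
  define I where "I = (INF \<beta>\<in>D. 1 / n * (norm (X *v \<beta> - f0))\<^sup>2)"
  have I: "1 / n * (norm (u - f0))\<^sup>2 \<le> I"
    unfolding I_def
  proof (rule cINF_greatest)
    fix \<beta> assume "\<beta> \<in> D"
    then have "dist f0 u \<le> dist f0 (X *v \<beta>)"
      unfolding u_def by (intro closest_point_le C(2)) (simp add: C_def)
    then show "1 / n * (norm (u - f0))\<^sup>2 \<le> 1 / n * (norm (X *v \<beta> - f0))\<^sup>2"
      using n by (intro mult_left_mono power_mono) (auto simp: dist_norm norm_minus_commute)
  qed (use D0 in auto)
  define E where "E = {\<omega> \<in> space P. 1 / n * (norm (fit \<omega> - f0))\<^sup>2
      \<le> I + 2 * lasso_rate \<sigma> R X + 4 * \<sigma>\<^sup>2 * x / n}"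
  have [measurable]: "\<xi> \<in> borel_measurable P" using assms(4) by (simp add: distributed_def)
  have "(\<lambda>\<omega>. closest_point C (f0 + \<xi> \<omega>)) \<in> borel_measurable P"
    using borel_measurable_continuous_onI[OF continuous_on_closest_point[OF C]]
    by (rule measurable_compose[rotated]) measurable
  \<comment> \<open>A minimizer \<open>\<beta>hat\<close> need be neither unique nor measurable, but the fitted vector is a
    projection, hence a continuous function of the noise; so the event is measurable.\<close>
  moreover have "closest_point C (f0 + \<xi> \<omega>) = fit \<omega>" if "\<omega> \<in> space P" for \<omega>
    using closest_point_unique[OF C(1,2) fit[OF that]] by simp
  ultimately have [measurable]: "fit \<in> borel_measurable P"
    using measurable_cong[of P "\<lambda>\<omega>. closest_point C (f0 + \<xi> \<omega>)" fit] by blast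
  have E: "E \<in> events" unfolding E_def by measurable
  define g where "g \<omega> = (1 / \<sigma>) *\<^sub>R \<xi> \<omega>" for \<omega>
  have g: "gaussian_mgf P g"
    using gaussian_mgf_of_density[OF assms(1,2,4)] by (simp add: g_def[abs_def])
  \<comment> \<open>Failure of the oracle inequality forces the localized process above its threshold.\<close>
  have excess: "2 * n * lasso_rate \<sigma> R X / \<sigma>\<^sup>2 + 4 * x
      < 2 * (g \<omega> \<bullet> ((1 / \<sigma>) *\<^sub>R fit \<omega> - (1 / \<sigma>) *\<^sub>R u)) - (norm ((1 / \<sigma>) *\<^sub>R fit \<omega> - (1 / \<sigma>) *\<^sub>R u))\<^sup>2"
    if "\<omega> \<in> space P - E" for \<omega>
  proof -
    have "I + 2 * lasso_rate \<sigma> R X + 4 * \<sigma>\<^sup>2 * x / n < 1 / n * (norm (fit \<omega> - f0))\<^sup>2"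
      using that by (auto simp: E_def not_le)
    then have "1 / n * (norm (u - f0))\<^sup>2 + 2 * lasso_rate \<sigma> R X + 4 * \<sigma>\<^sup>2 * x / n < 1 / n * (norm (fit \<omega> - f0))\<^sup>2"
      using I by linarith
    from mult_strict_left_mono[OF this n]
    have "(norm (u - f0))\<^sup>2 + 2 * n * lasso_rate \<sigma> R X + 4 * \<sigma>\<^sup>2 * x < (norm (fit \<omega> - f0))\<^sup>2"
      using n by (simp add: distrib_left mult_ac)
    also have "\<dots> \<le> (norm (u - f0))\<^sup>2 + 2 * (\<xi> \<omega> \<bullet> (fit \<omega> - u)) - (norm (fit \<omega> - u))\<^sup>2"
      using projection_basic_inequality[OF C(1,2) _ uC] fit[of \<omega>] that by blast
    finally have "(2 * n * lasso_rate \<sigma> R X + 4 * \<sigma>\<^sup>2 * x) / \<sigma>\<^sup>2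
        < (2 * (\<xi> \<omega> \<bullet> (fit \<omega> - u)) - (norm (fit \<omega> - u))\<^sup>2) / \<sigma>\<^sup>2"
      using \<sigma> by (intro divide_strict_right_mono) auto
    moreover have "(2 * n * lasso_rate \<sigma> R X + 4 * \<sigma>\<^sup>2 * x) / \<sigma>\<^sup>2 = 2 * n * lasso_rate \<sigma> R X / \<sigma>\<^sup>2 + 4 * x"
      using \<sigma> by (simp add: add_divide_distrib)
    moreover have "(1 / \<sigma>) *\<^sub>R fit \<omega> - (1 / \<sigma>) *\<^sub>R u = (1 / \<sigma>) *\<^sub>R (fit \<omega> - u)"
      by (simp add: scaleR_diff_right)
    ultimately show ?thesis
      by (simp add: g_def power_divide power2_eq_square[of \<sigma>] diff_divide_distrib)
  qed
  have "prob (space P - E) < exp (- x)"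
  proof (cases "lasso_rate \<sigma> R X = 4 * \<sigma>\<^sup>2 * real (rank X) / n")
    case True
    have W: "subspace (range (\<lambda>\<beta>. X *v \<beta>))" by (rule linear_subspace_image[OF lin subspace_UNIV])
    show ?thesis
    proof (rule gaussian_subspace_tail[OF assms(1) g _ W assms(8)])
      fix \<omega> assume \<omega>: "\<omega> \<in> space P - E"
      have "2 * n * lasso_rate \<sigma> R X / \<sigma>\<^sup>2 = 8 * real (dim (range (\<lambda>\<beta>. X *v \<beta>)))"
        using True n \<sigma> by (simp add: rank_dim_range)
      moreover have "(1 / \<sigma>) *\<^sub>R fit \<omega> - (1 / \<sigma>) *\<^sub>R u \<in> range (\<lambda>\<beta>. X *v \<beta>)"
        using fit(1)[of \<omega>] uC \<omega> W by (intro subspace_diff[OF W] subspace_scale[OF W]) (auto simp: C_def)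
      ultimately show "\<exists>h\<in>range (\<lambda>\<beta>. X *v \<beta>). 8 * real (dim (range (\<lambda>\<beta>. X *v \<beta>))) + 4 * x
          < 2 * (g \<omega> \<bullet> h) - (norm h)\<^sup>2"
        using excess[OF \<omega>] by (intro bexI) auto
    qed (use E in auto)
  next
    case False
    define S where "S = R * sqrt n / \<sigma>"
    define q where "q = 2 * exp 1 * real CARD('m) * \<sigma> / (R * sqrt n)"
    define V where "V = range (\<lambda>j. (1 / \<sigma> * R) *\<^sub>R column j X) \<union> range (\<lambda>j. - ((1 / \<sigma> * R) *\<^sub>R column j X))"
    have S: "0 < S" and q: "0 < q" using n \<sigma> R by (simp_all add: S_def q_def)
    have rate: "lasso_rate \<sigma> R X = 62 * \<sigma> * R * sqrt (log_plus q) / sqrt n"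
      using False by (simp add: lasso_rate_def Let_def n_def q_def min_def split: if_splits)
    have V: "finite V" by (simp add: V_def)
    have bound: "norm v \<le> S" if "v \<in> V" for v
    proof -
      have "norm (column j X) \<le> sqrt n" for j
        using assms(6)[of j] n by (intro real_le_rsqrt) (simp add: n_def divide_le_eq)
      then have "1 / \<sigma> * R * norm (column j X) \<le> 1 / \<sigma> * R * sqrt n" for j
        using \<sigma> R by (intro mult_left_mono) auto
      then show ?thesis using that \<sigma> R by (auto simp: V_def S_def)
    qed
    have hull: "(1 / \<sigma>) *\<^sub>R z \<in> convex hull V" if "z \<in> C" for z
      using that l1_ball_image_in_hull[OF R, of _ "1 / \<sigma>" X] by (auto simp: C_def D_def V_def)
    have "convex hull V \<subseteq> cball 0 S"
      by (rule hull_minimal) (use bound in auto)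
    then have w: "norm ((1 / \<sigma>) *\<^sub>R u) \<le> S" using hull[OF uC] by auto
    have card: "exp 1 * real (card V) / S \<le> exp (log_plus q)"
    proof -
      have "card V \<le> CARD('m) + CARD('m)"
        unfolding V_def by (intro order_trans[OF card_Un_le] add_mono card_image_le) auto
      then have "exp 1 * real (card V) / S \<le> exp 1 * (2 * real CARD('m)) / S"
        using S by (intro divide_right_mono mult_left_mono) auto
      also have "\<dots> = q" using \<sigma> R n by (simp add: S_def q_def)
      also have "\<dots> = exp (ln q)" using q by simp
      also have "\<dots> \<le> exp (log_plus q)" by (simp add: log_plus_def)
      finally show ?thesis .
    qed
    show ?thesis
    proof (rule gaussian_hull_tail[OF assms(1) g _ V S bound w _ card assms(8)])
      fix \<omega> assume \<omega>: "\<omega> \<in> space P - E"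
      have "2 * n * lasso_rate \<sigma> R X / \<sigma>\<^sup>2 = 124 * (n / sqrt n) * (R / \<sigma>) * sqrt (log_plus q)"
        using \<sigma> n by (simp add: rate power2_eq_square)
      also have "\<dots> = 124 * S * sqrt (log_plus q)" using n by (simp add: S_def real_div_sqrt)
      finally show "\<exists>z\<in>convex hull V. 124 * S * sqrt (log_plus q) + 4 * x
          < 2 * (g \<omega> \<bullet> (z - (1 / \<sigma>) *\<^sub>R u)) - (norm (z - (1 / \<sigma>) *\<^sub>R u))\<^sup>2"
        using excess[OF \<omega>] hull[OF fit(1)[of \<omega>]] \<omega> by (intro bexI) auto
    qed (use E in \<open>auto simp: log_plus_def\<close>)
  qed
  then have "prob E > 1 - exp (- x)" using prob_compl[OF E] by simp
  then show ?thesis by (simp add: E_def I_def D_def fit_def n_def)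
qed

end
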